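(* Let $\nu>-1$ and let $\varphi,\psi$ be nonnegative functions defined on $\mathbb{R}_+=(0,\infty)$ which are related by $$\varphi(t)=\frac1t\int_0^\infty e^{-x/t}\psi(x)\,dx,\qquad t>0 .$$ Assume that $$\int_0^\infty x^k\rho_\nu(x)\psi(x)\,dx<\infty\quad\text{for all }k\in\mathbb{N}_0,$$ and that for some $M>0$ $$\int_0^\infty x^k e^{-x/M}\psi(x)\,dx<\infty\quad\text{for all }k\in\mathbb{N}_0 .$$ Let $\{P_n\}_{n\ge0}$ be the sequence of orthogonal (orthonormal) polynomials with respect to the measure $\rho_\nu(x)\psi(x)\,dx$ over $\mathbb{R}_+$. Then $\{P_n\}_{n\ge 0}$ is compositionally orthogonal in the sense of Laguerre relatively to the function $\varphi$, i.e. for all $n,m\in\mathbb{N}_0$ $$\int_0^\infty P_n(\theta)P_m(\theta)\{\varphi(t)\}\,t^\nu e^{-t}\,dt=\int_0^\infty P_n(x)P_m(x)\rho_\nu(x)\psi(x)\,dx=\delta_{n,m}.$$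
   Context: $\theta=tDt$ with $D=d/dt$, i.e. $\theta\{f\}(t)=t\frac{d}{dt}\big(t f(t)\big)$; for a polynomial $P(x)=\sum_k p_kx^k$, $P(\theta)=\sum_k p_k\theta^k$. For $x>0$, $\rho_\nu(x)=2x^{\nu/2}K_\nu(2\sqrt x)=\int_0^\infty t^{\nu-1}e^{-t-x/t}\,dt$, where $K_\nu$ is the modified Bessel function of the second kind (Macdonald function). Here $P_n$ is a real polynomial of degree $n$, and $\delta_{n,m}$ is the Kronecker symbol. *)

theory Defs
  imports "HOL-Analysis.Analysis" "HOL-Computational_Algebra.Polynomial"
begin

text \<open>
  Functions on the positive half-line are total functions \<open>real \<Rightarrow> real\<close> whose values outside
  \<open>{0<..}\<close> are irrelevant. The operator \<open>\<theta> = t D t\<close> only looks at a neighbourhood of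
  its argument, so it respects this convention.
\<close>

definition theta :: "(real \<Rightarrow> real) \<Rightarrow> real \<Rightarrow> real" where
  "theta f = (\<lambda>t. t * deriv (\<lambda>s. s * f s) t)"

definition poly_theta :: "real poly \<Rightarrow> (real \<Rightarrow> real) \<Rightarrow> real \<Rightarrow> real" where
  "poly_theta p f = (\<lambda>t. \<Sum>k\<le>degree p. coeff p k * (theta ^^ k) f t)"

text \<open>
  \<open>\<rho>\<^sub>\<nu>(x) = 2 x\<^bsup>\<nu>/2\<^esup> K\<^sub>\<nu>(2 \<surd>x)\<close> for \<open>x > 0\<close>, where \<open>K\<^sub>\<nu>\<close> is the Macdonald function,
  given by its integral representation.
\<close>

definition macdonald_rho :: "real \<Rightarrow> real \<Rightarrow> real" where
  "macdonald_rho \<nu> x = (LINT t:{0<..}|lebesgue. t powr (\<nu> - 1) * exp (- t - x / t))"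

definition orthonormal_polys :: "(real \<Rightarrow> real) \<Rightarrow> (nat \<Rightarrow> real poly) \<Rightarrow> bool" where
  "orthonormal_polys w P \<longleftrightarrow>
     (\<forall>n. degree (P n) = n) \<and>
     (\<forall>n m. set_integrable lebesgue {0<..} (\<lambda>x. poly (P n) x * poly (P m) x * w x) \<and>
            (LINT x:{0<..}|lebesgue. poly (P n) x * poly (P m) x * w x)
              = (if n = m then 1 else 0))"

text \<open>
  Compositional orthogonality in the sense of Laguerre. As \<^const>\<open>deriv\<close> and the Lebesgue
  integral are total, the existence of all the derivatives that enter the iterates of
  \<^const>\<open>theta\<close>, and of the integrals, is required explicitly.
\<close>

definition comp_orthogonal :: "real \<Rightarrow> (real \<Rightarrow> real) \<Rightarrow> (nat \<Rightarrow> real poly) \<Rightarrow> bool" where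
  "comp_orthogonal \<nu> \<phi> P \<longleftrightarrow>
     (\<forall>k. \<forall>t>0. (\<lambda>s. s * (theta ^^ k) \<phi> s) differentiable (at t)) \<and>
     (\<forall>n m. set_integrable lebesgue {0<..}
              (\<lambda>t. poly_theta (P n) (poly_theta (P m) \<phi>) t * t powr \<nu> * exp (- t)) \<and>
            (LINT t:{0<..}|lebesgue.
               poly_theta (P n) (poly_theta (P m) \<phi>) t * t powr \<nu> * exp (- t))
              = (if n = m then 1 else 0))"

end

theory Submission
  imports Defs
begin

text \<open>
  On functions of the form \<open>t \<mapsto> 1/t \<integral> e\<^bsup>-x/t\<^esup> h(x) dx\<close> the operator \<open>\<theta>\<close> acts as
  multiplication of \<open>h\<close> by \<open>x\<close>, so that \<open>P\<^sub>n(\<theta>) P\<^sub>m(\<theta>) \<phi>\<close> arises from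
  \<open>h = P\<^sub>n P\<^sub>m \<psi>\<close>. Integrating against \<open>t\<^bsup>\<nu>\<^esup> e\<^bsup>-t\<^esup>\<close> and exchanging the integrals, the inner
  integral over \<open>t\<close> becomes \<open>\<rho>\<^sub>\<nu>(x)\<close>. All Laplace integrals converge, for every \<open>t > 0\<close> and not
  just \<open>t \<le> M\<close>, because \<open>e\<^bsup>-x/t\<^esup> \<le> C\<^sub>t \<rho>\<^sub>\<nu>(x)\<close>: restrict the integral defining \<open>\<rho>\<^sub>\<nu>\<close> to \<open>[t, t+1]\<close>.
\<close>

section \<open>Sigma-finiteness of Lebesgue measure, for use in Fubini's theorem\<close>

lemma sigma_finite_lebesgue: "sigma_finite_measure (lebesgue :: 'a::euclidean_space measure)"
proof -
  obtain A :: "'a set set" where A: "countable A" "A \<subseteq> sets lborel" "\<Union>A = space lborel"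
    "\<forall>a\<in>A. emeasure lborel a \<noteq> \<infinity>"
    using lborel.sigma_finite_countable by blast
  show ?thesis
    \<comment> \<open>Borel sets keep their measure under completion, so the cover found for
      \<open>lborel\<close> also serves \<open>lebesgue\<close>.\<close>
    by standard (use A in \<open>auto intro!: exI[of _ A]\<close>)
qed

interpretation lebesgue_pair: pair_sigma_finite "lebesgue :: real measure" "lebesgue :: real measure"
  by (simp add: pair_sigma_finite_def sigma_finite_lebesgue)

section \<open>Differentiation of Laplace integrals in the parameter\<close>

text \<open>Dominated convergence applied to the difference quotients. The majorant uses
  \<open>i1\<close> at the parameter \<open>2*t\<close>, not at \<open>t\<close> itself. Condition
  \<open>g0\<close> confines the estimate to \<open>x > 0\<close>, where
  \<open>exp (- x / s)\<close> increases with \<open>s\<close>.\<close>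

lemma has_real_derivative_laplace:
  fixes g :: "real \<Rightarrow> real"
  assumes t: "t > 0"
    and g0: "\<And>x. x \<le> 0 \<Longrightarrow> g x = 0"
    and i0: "\<And>s. s > 0 \<Longrightarrow> integrable M (\<lambda>x. exp (- x / s) * g x)"
    and i1: "\<And>s. s > 0 \<Longrightarrow> integrable M (\<lambda>x. x * exp (- x / s) * g x)"
  shows "((\<lambda>s. \<integral>x. exp (- x / s) * g x \<partial>M) has_real_derivative
           (\<integral>x. x * exp (- x / t) * g x \<partial>M) / t\<^sup>2) (at t)"
proof -
  \<comment> \<open>Keeping \<open>s\<close> within a factor 2 of \<open>t\<close> gives both
    \<open>1 / s^2 \<le> 4 / t^2\<close> and \<open>exp (- x / s) \<le> exp (- x / (2*t))\<close>
    for \<open>x > 0\<close>; this is the source of the constants in the majorant.\<close>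
  define I where "I = {t/2<..<2*t}"
  have I: "open I" "t \<in> I" "convex I" using t by (auto simp: I_def)
  have pos: "s > 0" if "s \<in> I" for s using that t by (auto simp: I_def)
  have der: "((\<lambda>s. exp (- x / s)) has_real_derivative (x * exp (- x / s) / s\<^sup>2)) (at s within S)"
    if "s > 0" for s x :: real and S
    using that by (auto intro!: derivative_eq_intros simp: power2_eq_square)
  have "((\<lambda>s. ((\<integral>x. exp (- x / s) * g x \<partial>M) - (\<integral>x. exp (- x / t) * g x \<partial>M)) / (s - t)) \<longlongrightarrow>
           (\<integral>x. x * exp (- x / t) * g x \<partial>M) / t\<^sup>2) (at t within I)"
    unfolding tendsto_at_iff_sequentially
  proof (intro allI impI)
    fix X :: "nat \<Rightarrow> real"
    assume X: "\<forall>i. X i \<in> I - {t}" and lim: "X \<longlonglongrightarrow> t"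
    have Xpos: "X i > 0" for i using X pos by blast
    define q where "q i x = (exp (- x / X i) - exp (- x / t)) / (X i - t) * g x" for i x
    have qi: "integrable M (q i)" for i
    proof -
      have "integrable M (\<lambda>x. (exp (- x / X i) * g x - exp (- x / t) * g x) / (X i - t))"
        using i0[OF Xpos[of i]] i0[OF t] by auto
      thus ?thesis by (rule back_subst[of "integrable M"]) (auto simp: q_def algebra_simps divide_simps)
    qed
    have "(\<lambda>i. \<integral>x. q i x \<partial>M) \<longlonglongrightarrow> (\<integral>x. x * exp (- x / t) / t\<^sup>2 * g x \<partial>M)"
    proof (rule integral_dominated_convergence)
      show "(\<lambda>x. x * exp (- x / t) / t\<^sup>2 * g x) \<in> borel_measurable M"
        using borel_measurable_divide[OF borel_measurable_integrable[OF i1[OF t]], of "\<lambda>_. t\<^sup>2"]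
        by simp
      show "q i \<in> borel_measurable M" for i using qi by auto
      show "integrable M (\<lambda>x. norm (x * exp (- x / (2*t)) * g x) * (4 / t\<^sup>2))"
        using i1[of "2*t"] t by (intro integrable_mult_left integrable_norm) auto
      show "AE x in M. (\<lambda>i. q i x) \<longlonglongrightarrow> x * exp (- x / t) / t\<^sup>2 * g x"
      proof (rule AE_I2)
        fix x
        have "((\<lambda>s. (exp (- x / s) - exp (- x / t)) / (s - t)) \<longlongrightarrow> x * exp (- x / t) / t\<^sup>2) (at t within I)"
          using der[OF t, of x I] by (simp add: has_field_derivative_iff)
        hence "(\<lambda>i. (exp (- x / X i) - exp (- x / t)) / (X i - t)) \<longlonglongrightarrow> x * exp (- x / t) / t\<^sup>2"
          using X lim unfolding tendsto_at_iff_sequentially comp_def by blast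
        thus "(\<lambda>i. q i x) \<longlonglongrightarrow> x * exp (- x / t) / t\<^sup>2 * g x"
          unfolding q_def by (intro tendsto_mult tendsto_const)
      qed
      show "AE x in M. norm (q i x) \<le> norm (x * exp (- x / (2*t)) * g x) * (4 / t\<^sup>2)" for i
      proof (rule AE_I2)
        fix x
        show "norm (q i x) \<le> norm (x * exp (- x / (2*t)) * g x) * (4 / t\<^sup>2)"
        proof (cases "x > 0")
          case False
          thus ?thesis by (simp add: q_def g0)
        next
          case True
          \<comment> \<open>The mean value inequality on the convex set \<open>I\<close> turns a
            bound on the derivative into a bound on the difference quotient that does not depend on
            \<open>i\<close>.\<close>
          have "norm (exp (- x / X i) - exp (- x / t)) \<le> (x * exp (- x / (2*t)) * (4 / t\<^sup>2)) * norm (X i - t)"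
          proof (rule field_differentiable_bound[OF I(3)])
            fix s assume s: "s \<in> I"
            show "((\<lambda>s. exp (- x / s)) has_real_derivative (x * exp (- x / s) / s\<^sup>2)) (at s within I)"
              using der pos s by blast
            have "(t/2)\<^sup>2 \<le> s\<^sup>2" using s t by (intro power_mono) (auto simp: I_def)
            hence "1 / s\<^sup>2 \<le> 4 / t\<^sup>2" using t pos[OF s] by (simp add: field_simps)
            moreover have "exp (- x / s) \<le> exp (- x / (2*t))"
              using s t True pos[OF s] by (auto simp: I_def field_simps)
            ultimately have "x * (exp (- x / s) * (1 / s\<^sup>2)) \<le> x * (exp (- x / (2*t)) * (4 / t\<^sup>2))"
              using True by (intro mult_left_mono mult_mono) auto
            thus "norm (x * exp (- x / s) / s\<^sup>2) \<le> x * exp (- x / (2*t)) * (4 / t\<^sup>2)"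
              using True by simp
          qed (use X I in auto)
          moreover have "X i \<noteq> t" using X by auto
          ultimately have "norm ((exp (- x / X i) - exp (- x / t)) / (X i - t)) \<le> x * exp (- x / (2*t)) * (4 / t\<^sup>2)"
            by (simp add: norm_divide divide_le_eq)
          hence "norm ((exp (- x / X i) - exp (- x / t)) / (X i - t)) * norm (g x)
                   \<le> x * exp (- x / (2*t)) * (4 / t\<^sup>2) * norm (g x)"
            by (intro mult_right_mono) auto
          thus ?thesis using True by (simp add: q_def norm_mult norm_divide abs_mult mult_ac)
        qed
      qed
    qed
    moreover have "(\<integral>x. q i x \<partial>M) =
        ((\<integral>x. exp (- x / X i) * g x \<partial>M) - (\<integral>x. exp (- x / t) * g x \<partial>M)) / (X i - t)" for i
    proof -
      have "(\<integral>x. q i x \<partial>M) = (\<integral>x. (exp (- x / X i) * g x - exp (- x / t) * g x) / (X i - t) \<partial>M)"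
        by (auto simp: q_def algebra_simps divide_simps intro!: Bochner_Integration.integral_cong)
      thus ?thesis using i0[OF Xpos[of i]] i0[OF t] by simp
    qed
    moreover have "(\<integral>x. x * exp (- x / t) / t\<^sup>2 * g x \<partial>M) = (\<integral>x. x * exp (- x / t) * g x \<partial>M) / t\<^sup>2"
      by (subst integral_divide_zero[symmetric]) (auto intro!: Bochner_Integration.integral_cong)
    ultimately show "((\<lambda>s. ((\<integral>x. exp (- x / s) * g x \<partial>M) - (\<integral>x. exp (- x / t) * g x \<partial>M)) / (s - t)) \<circ> X)
          \<longlonglongrightarrow> (\<integral>x. x * exp (- x / t) * g x \<partial>M) / t\<^sup>2"
      by (simp add: comp_def)
  qed
  thus ?thesis
    by (simp add: has_field_derivative_iff at_within_open[OF I(2,1)])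
qed

section \<open>The weight \<open>\<rho>\<close>: convergence and a lower bound\<close>

text \<open>Since \<open>exp (- x / t) \<le> t / x\<close>, the integrand is at most
  \<open>t powr \<nu> * exp (- t) / x\<close>. Up to the factor \<open>1 / x\<close> this is the
  Gamma integrand at \<open>\<nu> + 1\<close>, which is positive by hypothesis.\<close>

lemma integrable_macdonald_rho:
  fixes \<nu> x :: real
  assumes "\<nu> > -1" "x > 0"
  shows "set_integrable lebesgue {0<..} (\<lambda>t. t powr (\<nu> - 1) * exp (- t - x / t))"
proof -
  \<comment> \<open>The Gamma integrand is complex-valued here; taking norms yields the real
    majorant.\<close>
  have "(\<lambda>t. complex_of_real t powr (of_real (\<nu> + 1) - 1) / of_real (exp t)) absolutely_integrable_on {0<..}"
    by (rule absolutely_integrable_Gamma_integral') (use assms in auto)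
  hence "set_integrable lebesgue {0<..} (\<lambda>t. norm (complex_of_real t powr (of_real (\<nu> + 1) - 1) / of_real (exp t)))"
    by (rule set_integrable_norm)
  also have "?this \<longleftrightarrow> set_integrable lebesgue {0<..} (\<lambda>t::real. t powr \<nu> * exp (- t))"
    by (intro set_integrable_cong) (auto simp: norm_divide norm_powr_real_powr exp_minus divide_simps)
  finally have "set_integrable lebesgue {0<..} (\<lambda>t::real. 1 / x * (t powr \<nu> * exp (- t)))"
    by (intro set_integrable_mult_right)
  thus ?thesis
  proof (rule set_integrable_bound)
    show "set_borel_measurable lebesgue {0<..} (\<lambda>t. t powr (\<nu> - 1) * exp (- t - x / t))"
      unfolding set_borel_measurable_def by (intro measurable_completion) measurable
    show "AE t in lebesgue. t \<in> {0<..} \<longrightarrow>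
       norm (t powr (\<nu> - 1) * exp (- t - x / t)) \<le> norm (1 / x * (t powr \<nu> * exp (- t)))"
    proof (intro AE_I2 impI)
      fix t :: real assume "t \<in> {0<..}"
      hence t: "t > 0" by simp
      have "x / t \<le> exp (x / t)" using exp_ge_add_one_self[of "x/t"] by linarith
      hence "exp (- (x / t)) \<le> t / x" using t assms
        by (simp add: exp_minus field_simps)
      hence "t powr (\<nu> - 1) * exp (- t) * exp (- (x / t)) \<le> t powr (\<nu> - 1) * exp (- t) * (t / x)"
        by (intro mult_left_mono) auto
      also have "t powr (\<nu> - 1) * exp (- t) * (t / x) = 1 / x * (t powr \<nu> * exp (- t))"
        using t by (simp add: powr_diff field_simps)
      finally have "t powr (\<nu> - 1) * exp (- t) * exp (- (x / t)) \<le> 1 / x * (t powr \<nu> * exp (- t))" .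
      moreover have "exp (- t - x / t) = exp (- t) * exp (- (x / t))"
        using exp_add[of "- t" "- (x / t)"] by simp
      ultimately show "norm (t powr (\<nu> - 1) * exp (- t - x / t)) \<le> norm (1 / x * (t powr \<nu> * exp (- t)))"
        using t assms by (simp add: abs_mult mult_ac)
    qed
  qed
qed

text \<open>On \<open>{t..t+1}\<close> the factor \<open>s powr (\<nu> - 1) * exp (- s)\<close> has
  a positive minimum \<open>c\<close>, and \<open>exp (- x / s) \<ge> exp (- x / t)\<close>. The
  interval has length 1, so integrating the constant \<open>c * exp (- x / t)\<close> over it
  returns that constant, and \<open>C = 1 / c\<close> works for every \<open>x > 0\<close>.\<close>

lemma exp_le_macdonald_rho:
  fixes \<nu> t :: real
  assumes "\<nu> > -1" "t > 0"
  obtains C where "C > 0" "\<And>x. x > 0 \<Longrightarrow> exp (- x / t) \<le> C * macdonald_rho \<nu> x"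
proof -
  obtain c where c: "c > 0" "\<And>s. s \<in> {t..t+1} \<Longrightarrow> c \<le> s powr (\<nu> - 1) * exp (- s)"
  proof -
    have "continuous_on {t..t+1} (\<lambda>s. s powr (\<nu> - 1) * exp (- s))"
      using assms by (intro continuous_intros) auto
    then obtain s where s: "s \<in> {t..t+1}"
      "\<And>r. r \<in> {t..t+1} \<Longrightarrow> s powr (\<nu> - 1) * exp (- s) \<le> r powr (\<nu> - 1) * exp (- r)"
      using continuous_attains_inf[of "{t..t+1}" "\<lambda>s. s powr (\<nu> - 1) * exp (- s)"] by auto
    show ?thesis by (rule that[of "s powr (\<nu> - 1) * exp (- s)"]) (use s assms in auto)
  qed
  have "exp (- x / t) \<le> 1 / c * macdonald_rho \<nu> x" if x: "x > 0" for x
  proof -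
    have "c * exp (- x / t) = (LINT s:{t..t+1}|lebesgue. c * exp (- x / t))"
      by (simp add: set_lebesgue_integral_def)
    also have "\<dots> \<le> (LINT s|lebesgue. indicator {0<..} s *\<^sub>R (s powr (\<nu> - 1) * exp (- s - x / s)))"
      unfolding set_lebesgue_integral_def
    proof (rule integral_mono)
      show "integrable lebesgue (\<lambda>s. indicator {t..t + 1} s *\<^sub>R (c * exp (- x / t)))" by simp
      show "integrable lebesgue (\<lambda>s. indicator {0<..} s *\<^sub>R (s powr (\<nu> - 1) * exp (- s - x / s)))"
        using integrable_macdonald_rho[OF assms(1) x] by (simp add: set_integrable_def)
      fix s :: real
      show "indicator {t..t + 1} s *\<^sub>R (c * exp (- x / t)) \<le> indicator {0<..} s *\<^sub>R (s powr (\<nu> - 1) * exp (- s - x / s))"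
      proof (cases "s \<in> {t..t+1}")
        case True
        hence "exp (- x / t) \<le> exp (- x / s)" using assms x by (auto simp: field_simps)
        hence "c * exp (- x / t) \<le> s powr (\<nu> - 1) * exp (- s) * exp (- x / s)"
          using c True by (intro mult_mono) auto
        moreover have "exp (- s - x / s) = exp (- s) * exp (- x / s)"
          using exp_add[of "- s" "- x / s"] by simp
        ultimately show ?thesis using True assms by (simp add: mult_ac)
      qed auto
    qed
    finally show ?thesis using c by (simp add: macdonald_rho_def set_lebesgue_integral_def field_simps)
  qed
  thus ?thesis using that[of "1 / c"] c by auto
qed


section \<open>Laplace means integrated against \<open>t powr \<nu> * exp (- t)\<close>\<close>

text \<open>The integral runs over the whole line. The restriction to the positive half-line is left
  to \<open>h\<close>, which vanishes on \<open>x \<le> 0\<close> wherever this is applied.\<close>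

definition laplace_mean :: "(real \<Rightarrow> real) \<Rightarrow> real \<Rightarrow> real" where
  "laplace_mean h t = 1 / t * (\<integral>x. exp (- x / t) * h x \<partial>lebesgue)"

text \<open>Fubini for the kernel \<open>F\<close> below: integrating first in \<open>t\<close>
  gives \<open>macdonald_rho \<nu> x * h x\<close>, integrating first in \<open>x\<close> gives the
  weighted mean, its factor \<open>1 / t\<close> being supplied by the exponent
  \<open>\<nu> - 1\<close>.\<close>

lemma
  fixes h :: "real \<Rightarrow> real"
  assumes h[measurable]: "h \<in> borel_measurable lebesgue"
    and h0: "\<And>x. x \<le> 0 \<Longrightarrow> h x = 0"
    and int: "integrable lebesgue (\<lambda>x. macdonald_rho \<nu> x * h x)"
    and \<nu>: "\<nu> > -1"
  shows set_integrable_laplace_mean: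
      "set_integrable lebesgue {0<..} (\<lambda>t. laplace_mean h t * t powr \<nu> * exp (- t))"
    and set_integral_laplace_mean:
      "(LINT t:{0<..}|lebesgue. laplace_mean h t * t powr \<nu> * exp (- t)) =
         (\<integral>x. macdonald_rho \<nu> x * h x \<partial>lebesgue)"
proof -
  define F where "F x t = indicator {0<..} t *\<^sub>R (t powr (\<nu> - 1) * exp (- t - x / t)) * h x" for x t :: real
  have id[measurable]: "(\<lambda>x. x) \<in> lebesgue \<rightarrow>\<^sub>M (borel :: real measure)"
    by (rule measurable_completion) simp
  \<comment> \<open>As \<open>h\<close> is only Lebesgue measurable, joint measurability refers to
    the product of the completed sigma-algebras. Composing the projections with \<open>id\<close>
    lets the other factors be treated as Borel functions.\<close>
  have meas: "case_prod F \<in> borel_measurable (lebesgue \<Otimes>\<^sub>M lebesgue)"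
  proof -
    have fst: "fst \<in> lebesgue \<Otimes>\<^sub>M lebesgue \<rightarrow>\<^sub>M (borel :: real measure)"
      and snd: "snd \<in> lebesgue \<Otimes>\<^sub>M lebesgue \<rightarrow>\<^sub>M (borel :: real measure)"
      using measurable_compose[OF measurable_fst id] measurable_compose[OF measurable_snd id] by auto
    have "(\<lambda>t::real. indicator {0<..} t *\<^sub>R (t powr (\<nu> - 1)) :: real) \<in> borel_measurable borel"
      by measurable
    note this[THEN measurable_compose[OF snd], measurable]
    show ?thesis using fst snd by (auto simp: F_def split_beta' intro!: borel_measurable_times) 
  qed
  have Ft: "integrable lebesgue (F x)" for x
  \<comment> \<open>For \<open>x < 0\<close> the kernel blows up as \<open>t\<close> tends to 0;
    there \<open>F x\<close> vanishes because of \<open>h0\<close>.\<close>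
  proof (cases "x > 0")
    case True
    thus ?thesis unfolding F_def
      using integrable_macdonald_rho[OF \<nu>, of x]
      by (intro integrable_mult_left) (simp add: set_integrable_def)
  next
    case False
    hence "F x = (\<lambda>_. 0)" by (auto simp: F_def h0)
    thus ?thesis by simp
  qed
  have Ft_eq: "(\<integral>t. F x t \<partial>lebesgue) = macdonald_rho \<nu> x * h x" for x
    by (simp add: F_def macdonald_rho_def set_lebesgue_integral_def)
  have Ft_norm: "(\<integral>t. norm (F x t) \<partial>lebesgue) = norm (macdonald_rho \<nu> x * h x)" for x
  proof -
    have "(\<integral>t. norm (F x t) \<partial>lebesgue) =
        (\<integral>t. indicator {0<..} t *\<^sub>R (t powr (\<nu> - 1) * exp (- t - x / t)) * norm (h x) \<partial>lebesgue)"
      by (rule Bochner_Integration.integral_cong) (auto simp: F_def norm_mult abs_mult)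
    also have "\<dots> = macdonald_rho \<nu> x * norm (h x)"
      by (simp add: macdonald_rho_def set_lebesgue_integral_def)
    \<comment> \<open>Positivity of the kernel makes absolute integrability of \<open>F\<close>
      equivalent to that of \<open>macdonald_rho \<nu> x * h x\<close>.\<close>
    also have "macdonald_rho \<nu> x \<ge> 0"
      unfolding macdonald_rho_def set_lebesgue_integral_def
      by (intro Bochner_Integration.integral_nonneg) (auto simp: indicator_def)
    hence "macdonald_rho \<nu> x * norm (h x) = norm (macdonald_rho \<nu> x * h x)"
      by (simp add: abs_mult)
    finally show ?thesis .
  qed
  have prod: "integrable (lebesgue \<Otimes>\<^sub>M lebesgue) (case_prod F)"
    by (rule lebesgue_pair.Fubini_integrable[OF meas]) (use Ft Ft_norm int in auto)
  have Fx_eq: "(\<integral>x. F x t \<partial>lebesgue) =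
      indicator {0<..} t *\<^sub>R (laplace_mean h t * t powr \<nu> * exp (- t))" for t
  proof (cases "t > 0")
    case True
    have "exp (- t - x / t) = exp (- t) * exp (- x / t)" for x
      using exp_add[of "- t" "- x / t"] by simp
    hence "(\<integral>x. F x t \<partial>lebesgue) =
        (\<integral>x. (t powr (\<nu> - 1) * exp (- t)) * (exp (- x / t) * h x) \<partial>lebesgue)"
      using True by (intro Bochner_Integration.integral_cong)
        (simp_all add: F_def)
    also have "\<dots> = (t powr (\<nu> - 1) * exp (- t)) * (\<integral>x. exp (- x / t) * h x \<partial>lebesgue)"
      by simp
    finally show ?thesis using True
      by (simp add: laplace_mean_def powr_diff field_simps)
  qed (simp add: F_def)
  show "set_integrable lebesgue {0<..} (\<lambda>t. laplace_mean h t * t powr \<nu> * exp (- t))"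
    using lebesgue_pair.integrable_snd[OF prod] by (simp add: Fx_eq set_integrable_def)
  show "(LINT t:{0<..}|lebesgue. laplace_mean h t * t powr \<nu> * exp (- t)) =
      (\<integral>x. macdonald_rho \<nu> x * h x \<partial>lebesgue)"
    using lebesgue_pair.Fubini_integral[OF prod]
    by (simp add: Fx_eq Ft_eq set_lebesgue_integral_def)
qed

section \<open>\<open>\<theta>\<close> as multiplication by \<open>x\<close> under the
  integral\<close>

text \<open>Integrability is required for all polynomials at once, so that the family of functions
  \<open>mean p\<close> is closed under \<open>theta\<close>.\<close>

locale laplace_weight =
  fixes g :: "real \<Rightarrow> real"
  assumes weight_nonpos: "\<And>x. x \<le> 0 \<Longrightarrow> g x = 0"
    and integrable_weight:
      "\<And>p t. t > 0 \<Longrightarrow> integrable lebesgue (\<lambda>x. exp (- x / t) * (poly p x * g x))"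
begin

abbreviation "mean p \<equiv> laplace_mean (\<lambda>x. poly p x * g x)"

text \<open>The factor \<open>s\<close> cancels the \<open>1 / s\<close> of the mean,
  differentiation produces \<open>x / t^2\<close>, and the outer factor \<open>t\<close> restores
  \<open>1 / t\<close>. A general \<open>f\<close> agreeing with the mean only on
  \<open>s > 0\<close> makes the result iterable.\<close>

lemma
  assumes f: "\<And>s. s > 0 \<Longrightarrow> f s = mean p s" and t: "t > 0"
  shows differentiable_mean: "(\<lambda>s. s * f s) differentiable (at t)"
    and theta_mean: "theta f t = mean (pCons 0 p) t"
proof -
  have "((\<lambda>s. \<integral>x. exp (- x / s) * (poly p x * g x) \<partial>lebesgue) has_real_derivative
           (\<integral>x. x * exp (- x / t) * (poly p x * g x) \<partial>lebesgue) / t\<^sup>2) (at t)"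
    by (rule has_real_derivative_laplace[OF t])
      (use weight_nonpos integrable_weight[of _ p] integrable_weight[of _ "pCons 0 p"] in \<open>auto simp: mult_ac\<close>)
  \<comment> \<open>Derivatives are local, so agreement of \<open>f\<close> with the mean near
    \<open>t\<close> suffices.\<close>
  moreover have "eventually (\<lambda>s. s > 0) (nhds t)"
    using t eventually_nhds_in_open[of "{0<..}" t] by simp
  hence "eventually (\<lambda>s. s * f s = (\<integral>x. exp (- x / s) * (poly p x * g x) \<partial>lebesgue)) (nhds t)"
    by eventually_elim (simp add: f laplace_mean_def)
  ultimately have D: "((\<lambda>s. s * f s) has_real_derivative
      (\<integral>x. x * exp (- x / t) * (poly p x * g x) \<partial>lebesgue) / t\<^sup>2) (at t)"
    by (subst DERIV_cong_ev[OF refl _ refl])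
  show "(\<lambda>s. s * f s) differentiable (at t)"
    using D real_differentiable_def by blast
  show "theta f t = mean (pCons 0 p) t"
    using DERIV_imp_deriv[OF D] t
    by (simp add: theta_def laplace_mean_def power2_eq_square mult_ac)
qed

lemma theta_funpow_mean:
  assumes f: "\<And>s. s > 0 \<Longrightarrow> f s = mean p s" and t: "t > 0"
  shows "(theta ^^ k) f t = mean (monom 1 k * p) t"
  using t
proof (induction k arbitrary: t)
  case (Suc k)
  show ?case
    using theta_mean[OF Suc.IH Suc.prems] by (simp add: monom_Suc)
qed (simp add: f)

text \<open>Linearity of the integral. Allowing any \<open>p\<close>, not just 1, is what permits
  two such operators to be composed.\<close>

lemma poly_theta_mean:
  assumes f: "\<And>s. s > 0 \<Longrightarrow> f s = mean p s" and t: "t > 0"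
  shows "poly_theta q f t = mean (q * p) t"
proof -
  have "poly_theta q f t = (\<Sum>k\<le>degree q. coeff q k * mean (monom 1 k * p) t)"
    by (simp add: poly_theta_def theta_funpow_mean[OF f t])
  also have "\<dots> = 1 / t * (\<Sum>k\<le>degree q. \<integral>x. coeff q k * (exp (- x / t) * (poly (monom 1 k * p) x * g x)) \<partial>lebesgue)"
    by (simp add: laplace_mean_def sum_distrib_left sum_divide_distrib)
  also have "\<dots> = 1 / t * (\<integral>x. (\<Sum>k\<le>degree q. coeff q k * (exp (- x / t) * (poly (monom 1 k * p) x * g x))) \<partial>lebesgue)"
    by (subst Bochner_Integration.integral_sum) (intro integrable_mult_right integrable_weight t, rule refl)
  also have "\<dots> = mean (q * p) t"
    by (simp add: laplace_mean_def poly_monom poly_altdef[of q] sum_distrib_left sum_distrib_right mult_ac)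
  finally show ?thesis .
qed

end

section \<open>Transfer of orthogonality from \<open>\<psi>\<close> to \<open>\<phi>\<close>\<close>

theorem proposition1:
  fixes \<nu> M :: real and \<phi> \<psi> :: "real \<Rightarrow> real" and P :: "nat \<Rightarrow> real poly"
  assumes "\<nu> > -1"
    and "\<And>t. t > 0 \<Longrightarrow> \<phi> t \<ge> 0"
    and "\<And>x. x > 0 \<Longrightarrow> \<psi> x \<ge> 0"
    and "\<And>t. t > 0 \<Longrightarrow> \<phi> t = 1 / t * (LINT x:{0<..}|lebesgue. exp (- x / t) * \<psi> x)"
    and "\<And>k::nat. set_integrable lebesgue {0<..} (\<lambda>x. x ^ k * macdonald_rho \<nu> x * \<psi> x)"
    and "M > 0"
    and "\<And>k::nat. set_integrable lebesgue {0<..} (\<lambda>x. x ^ k * exp (- x / M) * \<psi> x)"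
    and "orthonormal_polys (\<lambda>x. macdonald_rho \<nu> x * \<psi> x) P"
  shows "comp_orthogonal \<nu> \<phi> P \<and>
    (\<forall>n m.
      (LINT t:{0<..}|lebesgue.
         poly_theta (P n) (poly_theta (P m) \<phi>) t * t powr \<nu> * exp (- t))
      = (LINT x:{0<..}|lebesgue. poly (P n) x * poly (P m) x * macdonald_rho \<nu> x * \<psi> x) \<and>
      (LINT x:{0<..}|lebesgue. poly (P n) x * poly (P m) x * macdonald_rho \<nu> x * \<psi> x)
      = (if n = m then 1 else 0))"
proof -
  define g where "g x = indicator {0<..} x * \<psi> x" for x :: real
  have id[measurable]: "(\<lambda>x. x) \<in> lebesgue \<rightarrow>\<^sub>M (borel :: real measure)"
    by (rule measurable_completion) simp
  \<comment> \<open>Measurability of \<open>\<psi>\<close> on the half-line is extracted from the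
    exponential moment with \<open>k = 0\<close>: multiplying by \<open>exp (x / M)\<close> cancels
    the exponential.\<close>
  have g[measurable]: "g \<in> borel_measurable lebesgue"
  proof -
    have "(\<lambda>x. exp (x / M) * (indicator {0<..} x *\<^sub>R (x ^ 0 * exp (- x / M) * \<psi> x)) :: real) \<in> borel_measurable lebesgue"
      using assms(7)[of 0, unfolded set_integrable_def, THEN borel_measurable_integrable]
      by measurable
    also have "?this \<longleftrightarrow> ?thesis"
      by (intro measurable_cong) (auto simp: g_def exp_minus)
    finally show ?thesis .
  qed
  have poly_meas[measurable]: "poly q \<in> borel_measurable lebesgue" for q :: "real poly"
    by (rule measurable_completion) (simp add: borel_measurable_continuous_onI continuous_intros)
  have rho_int: "integrable lebesgue (\<lambda>x. macdonald_rho \<nu> x * (poly q x * g x))" for q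
  proof -
    have "integrable lebesgue (\<lambda>x. \<Sum>k\<le>degree q. coeff q k * (indicator {0<..} x *\<^sub>R (x ^ k * macdonald_rho \<nu> x * \<psi> x)))"
      using assms(5) by (intro Bochner_Integration.integrable_sum integrable_mult_right) (simp add: set_integrable_def)
    thus ?thesis
      by (rule back_subst[of "integrable lebesgue"])
        (auto simp: g_def poly_altdef sum_distrib_left sum_distrib_right mult_ac)
  qed
  \<comment> \<open>The bound of \<open>exp (- x / t)\<close> by a multiple of
    \<open>macdonald_rho \<nu> x\<close> converts the moments against \<open>\<rho>\<close> into
    Laplace integrability at every \<open>t > 0\<close>.\<close>
  interpret laplace_weight g
  proof
    show "integrable lebesgue (\<lambda>x. exp (- x / t) * (poly q x * g x))" if t: "t > 0" for t q
    proof -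
      obtain C where C: "C > 0" "\<And>x. x > 0 \<Longrightarrow> exp (- x / t) \<le> C * macdonald_rho \<nu> x"
        using exp_le_macdonald_rho[OF assms(1) t] by blast
      show ?thesis
      proof (rule Bochner_Integration.integrable_bound)
        show "integrable lebesgue (\<lambda>x. C * (macdonald_rho \<nu> x * (poly q x * g x)))"
          using rho_int by simp
        show "AE x in lebesgue. norm (exp (- x / t) * (poly q x * g x)) \<le>
            norm (C * (macdonald_rho \<nu> x * (poly q x * g x)))"
        proof (rule AE_I2)
          fix x :: real
          show "norm (exp (- x / t) * (poly q x * g x)) \<le> norm (C * (macdonald_rho \<nu> x * (poly q x * g x)))"
          proof (cases "x > 0")
            case True
            hence "norm (exp (- x / t)) \<le> norm (C * macdonald_rho \<nu> x)"
              using C(2)[OF True] by auto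
            hence "norm (exp (- x / t)) * norm (poly q x * g x) \<le> norm (C * macdonald_rho \<nu> x) * norm (poly q x * g x)"
              by (rule mult_right_mono) simp
            thus ?thesis by (simp add: norm_mult abs_mult mult_ac)
          qed (simp add: g_def)
        qed
      qed measurable
    qed
  qed (simp add: g_def)
  have phi: "\<phi> t = mean 1 t" if "t > 0" for t
    using assms(4)[OF that] by (simp add: laplace_mean_def set_lebesgue_integral_def g_def mult_ac)
  have inner: "poly_theta (P m) \<phi> t = mean (P m) t" if "t > 0" for m t
    using poly_theta_mean[OF phi that, of "P m"] by simp
  \<comment> \<open>Here \<open>inner\<close> plays the role of the hypothesis on \<open>f\<close>,
    with \<open>p = P m\<close>.\<close>
  have outer: "poly_theta (P n) (poly_theta (P m) \<phi>) t = mean (P n * P m) t" if "t > 0" for n m t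
    by (rule poly_theta_mean[OF inner that])
  have diff: "(\<lambda>s. s * (theta ^^ k) \<phi> s) differentiable (at t)" if "t > 0" for k t
    by (rule differentiable_mean[OF theta_funpow_mean[OF phi] that])
  have int: "set_integrable lebesgue {0<..}
      (\<lambda>t. poly_theta (P n) (poly_theta (P m) \<phi>) t * t powr \<nu> * exp (- t))" for n m
    using set_integrable_laplace_mean[OF _ _ rho_int[of "P n * P m"] assms(1)]
    by (subst set_integrable_cong[OF refl refl, where f' = "\<lambda>t. mean (P n * P m) t * t powr \<nu> * exp (- t)"])
      (auto simp: outer weight_nonpos)
  have eq: "(LINT t:{0<..}|lebesgue.
         poly_theta (P n) (poly_theta (P m) \<phi>) t * t powr \<nu> * exp (- t))
      = (LINT x:{0<..}|lebesgue. poly (P n) x * poly (P m) x * macdonald_rho \<nu> x * \<psi> x)" for n m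
  proof -
    have "(LINT t:{0<..}|lebesgue.
         poly_theta (P n) (poly_theta (P m) \<phi>) t * t powr \<nu> * exp (- t)) =
        (LINT t:{0<..}|lebesgue. mean (P n * P m) t * t powr \<nu> * exp (- t))"
      by (intro set_lebesgue_integral_cong) (auto simp: outer)
    also have "\<dots> = (\<integral>x. macdonald_rho \<nu> x * (poly (P n * P m) x * g x) \<partial>lebesgue)"
      by (rule set_integral_laplace_mean[OF _ _ rho_int assms(1)]) (auto simp: weight_nonpos)
    also have "\<dots> = (LINT x:{0<..}|lebesgue. poly (P n) x * poly (P m) x * macdonald_rho \<nu> x * \<psi> x)"
      by (simp add: set_lebesgue_integral_def g_def mult_ac)
    finally show ?thesis .
  qed
  have orth: "(LINT x:{0<..}|lebesgue. poly (P n) x * poly (P m) x * macdonald_rho \<nu> x * \<psi> x) =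
      (if n = m then 1 else 0)" for n m
    using assms(8) unfolding orthonormal_polys_def by (simp add: mult.assoc)
  show ?thesis
    unfolding comp_orthogonal_def using diff int eq orth by simp
qed

end
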